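(* Let $X_1,\ldots,X_n$ be (generally dependent) $L$-valued random variables on a common probability space. The following two assertions are equivalent. (A) For every nondecreasing set function $w:2^{[n]}\to L$ (that is, for an arbitrary weighted lattice polynomial $p_w$), the c.d.f. $F_Y$ of $Y=p_w(X_1,\ldots,X_n)$ satisfies, for all $y\in L$, $$1-F_Y(y)=\sum_{s=0}^n\overline{\omega}_s\,\big[F_{(n-s)}(y)-F_{(n-s+1)}(y)\big],$$ where $$\overline{\omega}_s=\frac{1}{\binom{n}{s}}\sum_{S\subseteq[n],\,|S|=s}\mathrm{Ind}(w(S)>y),\qquad s=0,\ldots,n.$$ (B) $X_1,\ldots,X_n$ possess cardinality symmetry: for any $x\in L$ there exists a function $g_x:\{0,1,\ldots,n\}\to[0,1]$ such that $\Pr(\vec\chi(x)=\vec\kappa)=g_x(|\vec\kappa|)$ for all $\vec\kappa\in\{0,1\}^n$.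
   Context: $[n]=\{1,\ldots,n\}$. $L\subseteq[-\infty,\infty]$ is a (totally ordered) bounded lattice with bottom element $a$ and top element $b$; $\wedge$ and $\vee$ denote min and max, empty meets equal $b$. For a nondecreasing set function $w:2^{[n]}\to L$ (i.e. $S\subseteq T$ implies $w(S)\leqslant w(T)$), $p_w:L^n\to L$ is the weighted lattice polynomial $p_w(\vec x)=\bigvee_{S\subseteq[n]}\big[w(S)\wedge\bigwedge_{i\in S}x_i\big]$. (Weighted lattice polynomials $L^n\to L$ are the functions built from projections and constants by finitely many applications of $\wedge$ and $\vee$; each is $p_w$ for a unique nondecreasing $w$.) The c.d.f. of a random variable $X$ is $F_X(y)=\Pr(X\leqslant y)$. $\mathrm{Ind}(A)\in\{0,1\}$ is the indicator of the event or condition $A$. $\vec\chi(x)=(\chi_1(x),\ldots,\chi_n(x))$ with $\chi_i(x)=\mathrm{Ind}(X_i>x)$, and $|\vec\kappa|=\sum_{i=1}^n\kappa_i$ for $\vec\kappa\in\{0,1\}^n$. For $k\in[n]$, the $k$th order statistic function is $f_k(\vec x)=x_{(k)}=\bigvee_{S\subseteq[n],\,|S|=n-k+1}\bigwedge_{i\in S}x_i$ (the $k$th smallest coordinate), and $F_{(k)}$ is the c.d.f. of $X_{(k)}=f_k(X_1,\ldots,X_n)$; by convention $F_{(0)}\equiv 1$ and $F_{(n+1)}\equiv 0$. *)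

theory Defs
  imports "HOL-Probability.Probability"
begin

text \<open>Vectors \<open>(x\<^sub>1, \<dots>, x\<^sub>n)\<close> are functions on \<open>nat\<close>, of which only the values on \<open>{1..n}\<close> matter.
  The parameter \<open>b\<close> is the top element of the lattice, that is, the value of the empty meet.\<close>

definition meet_over :: "ereal \<Rightarrow> nat set \<Rightarrow> (nat \<Rightarrow> ereal) \<Rightarrow> ereal" where
  "meet_over b S x = (if S = {} then b else Min (x ` S))"

definition weighted_lattice_poly ::
    "ereal \<Rightarrow> nat \<Rightarrow> (nat set \<Rightarrow> ereal) \<Rightarrow> (nat \<Rightarrow> ereal) \<Rightarrow> ereal" where
  "weighted_lattice_poly b n w x = Max ((\<lambda>S. min (w S) (meet_over b S x)) ` Pow {1..n})"

text \<open>Intended for \<open>1 \<le> k \<le> n\<close> only, in which case no empty meet or join occurs.\<close>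

definition order_stat :: "nat \<Rightarrow> nat \<Rightarrow> (nat \<Rightarrow> ereal) \<Rightarrow> ereal" where
  "order_stat n k x = Max ((\<lambda>S. Min (x ` S)) ` {S. S \<subseteq> {1..n} \<and> card S = n - k + 1})"

text \<open>The library's \<open>cdf\<close> is restricted to measures on the reals, hence this version.\<close>

definition ereal_cdf :: "'a measure \<Rightarrow> ('a \<Rightarrow> ereal) \<Rightarrow> ereal \<Rightarrow> real" where
  "ereal_cdf M Z y = \<P>(\<omega> in M. Z \<omega> \<le> y)"

definition order_stat_cdf ::
    "'a measure \<Rightarrow> nat \<Rightarrow> (nat \<Rightarrow> 'a \<Rightarrow> ereal) \<Rightarrow> nat \<Rightarrow> ereal \<Rightarrow> real" where
  "order_stat_cdf M n X k y =
     (if k = 0 then 1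
      else if k = n + 1 then 0
      else ereal_cdf M (\<lambda>\<omega>. order_stat n k (\<lambda>i. X i \<omega>)) y)"

definition omega_bar :: "nat \<Rightarrow> (nat set \<Rightarrow> ereal) \<Rightarrow> ereal \<Rightarrow> nat \<Rightarrow> real" where
  "omega_bar n w y s =
     1 / real (n choose s) * (\<Sum>S | S \<subseteq> {1..n} \<and> card S = s. of_bool (w S > y))"

text \<open>The set \<open>{0, 1}\<^sup>n\<close> is rendered as \<open>{1..n} \<rightarrow>\<^sub>E {0, 1}\<close>, so that indicator vectors
  are compared on \<open>{1..n}\<close> only.\<close>

definition indicator_vec :: "nat \<Rightarrow> (nat \<Rightarrow> 'a \<Rightarrow> ereal) \<Rightarrow> ereal \<Rightarrow> 'a \<Rightarrow> nat \<Rightarrow> nat" where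
  "indicator_vec n X x \<omega> = (\<lambda>i\<in>{1..n}. of_bool (X i \<omega> > x))"

definition cardinality_symmetric ::
    "'a measure \<Rightarrow> ereal set \<Rightarrow> nat \<Rightarrow> (nat \<Rightarrow> 'a \<Rightarrow> ereal) \<Rightarrow> bool" where
  "cardinality_symmetric M L n X \<longleftrightarrow>
     (\<forall>x\<in>L. \<exists>g :: nat \<Rightarrow> real. g \<in> {0..n} \<rightarrow> {0..1} \<and>
        (\<forall>\<kappa> \<in> {1..n} \<rightarrow>\<^sub>E {0, 1}.
           \<P>(\<omega> in M. indicator_vec n X x \<omega> = \<kappa>) = g (\<Sum>i=1..n. \<kappa> i)))"

end

theory Submission imports Defs begin

text \<open>
  Fix a level \<open>y\<close> and let \<open>T\<close> be the random set of the indices \<open>i\<close> with \<open>X\<^sub>i > y\<close>. Every quantity in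
  the theorem depends only on the law of \<open>T\<close>, a distribution on the finite set \<open>Pow {1..n}\<close>.

  For the left-hand side of the identity: a join of meets exceeds \<open>y\<close> exactly when one of the meets
  does, so \<open>p\<^sub>w(X) > y\<close> holds iff some \<open>S \<subseteq> T\<close> has \<open>w(S) > y\<close>, that is, by monotonicity, iff
  \<open>w(T) > y\<close> (\<open>weighted_lattice_poly_greater_iff\<close>). Hence \<open>1 - F\<^sub>Y(y)\<close> is the sum of \<open>Pr(T = S)\<close> over
  the up-set of all \<open>S\<close> with \<open>w(S) > y\<close>. For the right-hand side: the \<open>k\<close>th order statistic exceeds
  \<open>y\<close> iff \<open>T\<close> has at least \<open>n - k + 1\<close> elements, so the differences of consecutive c.d.f.s are
  \<open>Pr(|T| = s)\<close> (\<open>order_stat_cdf_diff\<close>). Grouping subsets by size, the right-hand side becomes the sum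
  over the same up-set of \<open>Pr(|T| = |S|) / binom(n, |S|)\<close>, the probability that \<open>S\<close> would receive if
  the law of \<open>T\<close> were averaged over the sets of each size.

  So the identity says that the law of \<open>T\<close> and its average over sizes give the same mass to an
  up-set. Cardinality symmetry says that the two laws coincide, which yields the identity at
  once. Conversely, every up-set arises from some two-valued \<open>w\<close> when \<open>y\<close> is below the top element,
  and the up-sets \<open>{S. K \<subseteq> S}\<close> and \<open>{S. K \<subset> S}\<close> differ exactly by \<open>K\<close>; subtracting the two identities
  shows that the laws agree at \<open>K\<close> (\<open>up_set_sums_determine\<close>).
\<close>

section \<open>The exceedance set of a vector\<close>

definition exceedance_set :: "nat \<Rightarrow> ereal \<Rightarrow> (nat \<Rightarrow> ereal) \<Rightarrow> nat set" where
  "exceedance_set n y x = {i \<in> {1..n}. y < x i}"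

lemma exceedance_set_subset: "exceedance_set n y x \<subseteq> {1..n}"
  by (auto simp: exceedance_set_def)

lemma card_exceedance_set_le: "card (exceedance_set n y x) \<le> n"
  using card_mono[OF finite_atLeastAtMost exceedance_set_subset, of n y x] by simp

lemma meet_over_greater_iff:
  assumes "finite S" "y < b"
  shows "y < meet_over b S x \<longleftrightarrow> (\<forall>i\<in>S. y < x i)"
  using assms by (auto simp: meet_over_def)

lemma weighted_lattice_poly_greater_iff:
  assumes mono: "mono_on (Pow {1..n}) w" and bound: "\<And>S. S \<subseteq> {1..n} \<Longrightarrow> w S \<le> b"
  shows "y < weighted_lattice_poly b n w x \<longleftrightarrow> y < w (exceedance_set n y x)"
proof -
  have term_iff: "y < min (w S) (meet_over b S x) \<longleftrightarrow> y < w S \<and> S \<subseteq> exceedance_set n y x"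
    if S: "S \<subseteq> {1..n}" for S
  proof (cases "y < w S")
    case True
    \<comment> \<open>The empty meet \<open>b\<close> then exceeds \<open>y\<close> too, in agreement with the void condition on \<open>S = {}\<close>.\<close>
    then have "y < b"
      using bound[OF S] by (rule less_le_trans)
    moreover have "finite S"
      using S by (rule finite_subset) simp
    ultimately show ?thesis
      using True S by (auto simp: meet_over_greater_iff exceedance_set_def)
  qed simp
  have "y < weighted_lattice_poly b n w x \<longleftrightarrow>
        (\<exists>S\<in>Pow {1..n}. y < min (w S) (meet_over b S x))"
    unfolding weighted_lattice_poly_def by (subst Max_gr_iff) auto
  also have "\<dots> \<longleftrightarrow> (\<exists>S. S \<subseteq> exceedance_set n y x \<and> y < w S)"
    using term_iff exceedance_set_subset[of n y x] by (meson PowD PowI order_trans)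
  also have "\<dots> \<longleftrightarrow> y < w (exceedance_set n y x)"
    using mono_onD[OF mono] exceedance_set_subset[of n y x]
    by (meson PowI order_refl order_trans less_le_trans)
  finally show ?thesis .
qed

lemma order_stat_greater_iff:
  assumes "1 \<le> k" "k \<le> n"
  shows "y < order_stat n k x \<longleftrightarrow> n - k + 1 \<le> card (exceedance_set n y x)"
proof -
  let ?F = "{S. S \<subseteq> {1..n} \<and> card S = n - k + 1}"
  have fin: "finite ?F"
    by (rule finite_subset[of _ "Pow {1..n}"]) auto
  have "{1..n - k + 1} \<in> ?F"
    using assms by auto
  then have ne: "?F \<noteq> {}"
    by blast
  have meet: "y < Min (x ` S) \<longleftrightarrow> S \<subseteq> exceedance_set n y x" if "S \<in> ?F" for S
  proof -
    have "finite S" "S \<noteq> {}"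
      using that by (auto intro: finite_subset)
    then show ?thesis
      using that by (auto simp: exceedance_set_def)
  qed
  have "y < order_stat n k x \<longleftrightarrow> (\<exists>S\<in>?F. y < Min (x ` S))"
    unfolding order_stat_def using fin ne by (subst Max_gr_iff) auto
  also have "\<dots> \<longleftrightarrow> (\<exists>S\<in>?F. S \<subseteq> exceedance_set n y x)"
    using meet by blast
  also have "\<dots> \<longleftrightarrow> n - k + 1 \<le> card (exceedance_set n y x)"
  proof
    assume "\<exists>S\<in>?F. S \<subseteq> exceedance_set n y x"
    then show "n - k + 1 \<le> card (exceedance_set n y x)"
      using card_mono[OF finite_subset[OF exceedance_set_subset finite_atLeastAtMost]]
      by (metis (mono_tags, lifting) mem_Collect_eq)
  next
    assume "n - k + 1 \<le> card (exceedance_set n y x)"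
    then obtain S where "S \<subseteq> exceedance_set n y x" "card S = n - k + 1"
      by (meson obtain_subset_with_card_n)
    then show "\<exists>S\<in>?F. S \<subseteq> exceedance_set n y x"
      using exceedance_set_subset[of n y x] by blast
  qed
  finally show ?thesis .
qed

text \<open>Indicator vectors and exceedance sets carry the same information, through the usual
  correspondence between 0-1 vectors and subsets.\<close>

lemma indicator_vec_eq_iff:
  assumes "\<kappa> \<in> {1..n} \<rightarrow>\<^sub>E {0, 1}"
  shows "indicator_vec n X y \<omega> = \<kappa> \<longleftrightarrow>
         exceedance_set n y (\<lambda>i. X i \<omega>) = {i \<in> {1..n}. \<kappa> i = 1}"
proof -
  have ext: "indicator_vec n X y \<omega> = \<kappa> \<longleftrightarrow> (\<forall>i\<in>{1..n}. of_bool (y < X i \<omega>) = \<kappa> i)"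
    unfolding indicator_vec_def using assms
    by (metis (no_types, lifting) PiE_restrict restrict_apply' restrict_ext)
  have "of_bool (y < X i \<omega>) = \<kappa> i \<longleftrightarrow> (y < X i \<omega> \<longleftrightarrow> \<kappa> i = 1)" if "i \<in> {1..n}" for i
    using PiE_mem[OF assms that] by auto
  then show ?thesis
    unfolding ext exceedance_set_def by blast
qed

lemma sum_zero_one_vec:
  fixes n :: nat
  assumes "\<kappa> \<in> {1..n} \<rightarrow>\<^sub>E {0, 1 :: nat}"
  shows "(\<Sum>i=1..n. \<kappa> i) = card {i \<in> {1..n}. \<kappa> i = 1}"
proof -
  have "(\<Sum>i=1..n. \<kappa> i) = (\<Sum>i\<in>{i \<in> {1..n}. \<kappa> i = 1}. 1)"
    by (intro sum.mono_neutral_cong_right) (use PiE_mem[OF assms] in force)+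
  then show ?thesis
    by simp
qed

section \<open>The law of the exceedance set\<close>

context prob_space
begin

lemma exceedance_pred_partition:
  "{\<omega> \<in> space M. Q (exceedance_set n y (\<lambda>i. X i \<omega>))} =
   (\<Union>S\<in>{S. S \<subseteq> {1..n} \<and> Q S}. {\<omega> \<in> space M. exceedance_set n y (\<lambda>i. X i \<omega>) = S})"
  using exceedance_set_subset by auto

lemma exceedance_event:
  assumes "\<And>i. i \<in> {1..n} \<Longrightarrow> X i \<in> borel_measurable M"
  shows "{\<omega> \<in> space M. exceedance_set n y (\<lambda>i. X i \<omega>) = S} \<in> events"
proof (cases "S \<subseteq> {1..n}")
  case True
  have "{\<omega> \<in> space M. exceedance_set n y (\<lambda>i. X i \<omega>) = S} =
        {\<omega> \<in> space M. \<forall>i\<in>{1..n}. y < X i \<omega> \<longleftrightarrow> i \<in> S}"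
    using True by (auto simp: exceedance_set_def)
  also have "\<dots> \<in> events"
  proof (rule sets.sets_Collect_finite_All)
    fix i assume "i \<in> {1..n}"
    note [measurable] = assms[OF this]
    show "{\<omega> \<in> space M. y < X i \<omega> \<longleftrightarrow> i \<in> S} \<in> events"
      by measurable
  qed simp
  finally show ?thesis .
next
  case False
  then have "{\<omega> \<in> space M. exceedance_set n y (\<lambda>i. X i \<omega>) = S} = {}"
    using exceedance_set_subset by blast
  then show ?thesis
    by (metis sets.empty_sets)
qed

lemma prob_exceedance:
  assumes "\<And>i. i \<in> {1..n} \<Longrightarrow> X i \<in> borel_measurable M"
  shows "\<P>(\<omega> in M. Q (exceedance_set n y (\<lambda>i. X i \<omega>))) =
         (\<Sum>S | S \<subseteq> {1..n} \<and> Q S. \<P>(\<omega> in M. exceedance_set n y (\<lambda>i. X i \<omega>) = S))"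
proof -
  have "finite {S. S \<subseteq> {1..n} \<and> Q S}"
    by (rule finite_subset[of _ "Pow {1..n}"]) auto
  then show ?thesis
    using exceedance_event[OF assms]
    unfolding exceedance_pred_partition
    by (intro finite_measure_finite_Union) (auto simp: disjoint_family_on_def)
qed

lemma exceedance_pred_event:
  assumes "\<And>i. i \<in> {1..n} \<Longrightarrow> X i \<in> borel_measurable M"
  shows "{\<omega> \<in> space M. Q (exceedance_set n y (\<lambda>i. X i \<omega>))} \<in> events"
proof -
  have "finite {S. S \<subseteq> {1..n} \<and> Q S}"
    by (rule finite_subset[of _ "Pow {1..n}"]) auto
  then show ?thesis
    using exceedance_event[OF assms] unfolding exceedance_pred_partition
    by (intro sets.finite_UN) auto
qed

lemma one_minus_cdf_weighted_lattice_poly: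
  assumes meas: "\<And>i. i \<in> {1..n} \<Longrightarrow> X i \<in> borel_measurable M"
    and mono: "mono_on (Pow {1..n}) w" and bound: "\<And>S. S \<subseteq> {1..n} \<Longrightarrow> w S \<le> b"
  shows "1 - ereal_cdf M (\<lambda>\<omega>. weighted_lattice_poly b n w (\<lambda>i. X i \<omega>)) y =
         (\<Sum>S | S \<subseteq> {1..n} \<and> y < w S. \<P>(\<omega> in M. exceedance_set n y (\<lambda>i. X i \<omega>) = S))"
proof -
  have "ereal_cdf M (\<lambda>\<omega>. weighted_lattice_poly b n w (\<lambda>i. X i \<omega>)) y =
        \<P>(\<omega> in M. \<not> y < w (exceedance_set n y (\<lambda>i. X i \<omega>)))"
    unfolding ereal_cdf_def
    by (simp only: weighted_lattice_poly_greater_iff[OF mono bound, symmetric] not_less)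
  also have "\<dots> = 1 - \<P>(\<omega> in M. y < w (exceedance_set n y (\<lambda>i. X i \<omega>)))"
    by (rule prob_neg, rule exceedance_pred_event[OF meas])
  finally show ?thesis
    by (simp only: prob_exceedance[OF meas, where Q = "\<lambda>S. y < w S"] diff_diff_eq2 add_diff_cancel_left')
qed

text \<open>The conventions for \<open>F\<^sub>(\<^sub>0\<^sub>)\<close> and \<open>F\<^sub>(\<^sub>n\<^sub>+\<^sub>1\<^sub>)\<close> are the values that make this formula uniform in \<open>k\<close>,
  since the exceedance set has between \<open>0\<close> and \<open>n\<close> elements.\<close>

lemma order_stat_cdf_eq:
  assumes "k \<le> n + 1"
  shows "order_stat_cdf M n X k y = \<P>(\<omega> in M. card (exceedance_set n y (\<lambda>i. X i \<omega>)) < n + 1 - k)"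
proof -
  consider "k = 0" | "k = n + 1" | "1 \<le> k" "k \<le> n"
    using assms by linarith
  then show ?thesis
  proof cases
    case 1
    then show ?thesis
      by (simp add: order_stat_cdf_def less_Suc_eq_le card_exceedance_set_le prob_space)
  next
    case 2
    then show ?thesis
      by (simp add: order_stat_cdf_def)
  next
    case 3
    then have "order_stat n k x \<le> y \<longleftrightarrow> card (exceedance_set n y x) < n + 1 - k" for x
      using order_stat_greater_iff[OF 3, of y x] by (auto simp: not_less[symmetric])
    with 3 show ?thesis
      by (simp add: order_stat_cdf_def ereal_cdf_def)
  qed
qed

lemma order_stat_cdf_diff:
  assumes meas: "\<And>i. i \<in> {1..n} \<Longrightarrow> X i \<in> borel_measurable M" and "s \<le> n"
  shows "order_stat_cdf M n X (n - s) y - order_stat_cdf M n X (n - s + 1) y =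
         \<P>(\<omega> in M. card (exceedance_set n y (\<lambda>i. X i \<omega>)) = s)"
proof -
  let ?c = "\<lambda>\<omega>. card (exceedance_set n y (\<lambda>i. X i \<omega>))"
  have "\<P>(\<omega> in M. ?c \<omega> < s + 1) = prob ({\<omega> \<in> space M. ?c \<omega> < s} \<union> {\<omega> \<in> space M. ?c \<omega> = s})"
    by (rule arg_cong[where f = prob]) auto
  also have "\<dots> = \<P>(\<omega> in M. ?c \<omega> < s) + \<P>(\<omega> in M. ?c \<omega> = s)"
    by (rule finite_measure_Union)
      (auto intro: exceedance_pred_event[OF meas, where Q = "\<lambda>S. card S < s"]
        exceedance_pred_event[OF meas, where Q = "\<lambda>S. card S = s"])
  finally show ?thesis
    using \<open>s \<le> n\<close> by (simp add: order_stat_cdf_eq)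
qed

end

section \<open>Averaging over subsets of equal size\<close>

lemma sum_Pow_by_card:
  fixes f :: "nat set \<Rightarrow> 'b :: comm_monoid_add"
  shows "(\<Sum>s=0..n. \<Sum>S | S \<subseteq> {1..n} \<and> card S = s. f S) = (\<Sum>S\<in>Pow {1..n}. f S)"
proof -
  have "(\<Sum>s=0..n. sum f {S \<in> Pow {1..n}. card S = s}) = sum f (Pow {1..n})"
    by (rule sum.group) (use card_mono[OF finite_atLeastAtMost, of _ 1 n] in auto)
  then show ?thesis
    by simp
qed

lemma sum_omega_bar:
  "(\<Sum>s=0..n. omega_bar n w y s * q s) =
   (\<Sum>S | S \<subseteq> {1..n} \<and> y < w S. q (card S) / real (n choose card S))"
proof -
  have "(\<Sum>s=0..n. omega_bar n w y s * q s) =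
        (\<Sum>s=0..n. \<Sum>S | S \<subseteq> {1..n} \<and> card S = s.
           of_bool (y < w S) * (q (card S) / real (n choose card S)))"
    unfolding omega_bar_def sum_distrib_left sum_distrib_right by (intro sum.cong refl) simp
  also have "\<dots> = (\<Sum>S\<in>Pow {1..n}. of_bool (y < w S) * (q (card S) / real (n choose card S)))"
    by (rule sum_Pow_by_card)
  also have "\<dots> = (\<Sum>S | S \<subseteq> {1..n} \<and> y < w S. q (card S) / real (n choose card S))"
    by (intro sum.mono_neutral_cong_right) auto
  finally show ?thesis .
qed

text \<open>Indicator functions of up-sets span all functions on the subsets of \<open>A\<close>: the point mass at
  \<open>K\<close> is the difference of the indicators of the up-sets of supersets and of strict supersets.\<close>

lemma up_set_sums_determine:
  fixes p r :: "'b set \<Rightarrow> real"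
  assumes "finite A" "K \<subseteq> A"
    and eq: "\<And>U. U \<subseteq> Pow A \<Longrightarrow> (\<And>S T. S \<in> U \<Longrightarrow> S \<subseteq> T \<Longrightarrow> T \<subseteq> A \<Longrightarrow> T \<in> U) \<Longrightarrow> sum p U = sum r U"
  shows "p K = r K"
proof -
  let ?U = "{S. S \<subseteq> A \<and> K \<subset> S}"
  have fin: "finite ?U"
    by (rule finite_subset[of _ "Pow A"]) (use \<open>finite A\<close> in auto)
  have "sum p ?U = sum r ?U"
    by (rule eq) auto
  moreover have "sum p (insert K ?U) = sum r (insert K ?U)"
    by (rule eq) (use \<open>K \<subseteq> A\<close> in auto)
  ultimately show ?thesis
    using fin by simp
qed

section \<open>Cardinality symmetry and the identity for the c.d.f.\<close>

text \<open>Symmetry forces \<open>g\<^sub>x(s)\<close> to be the average of \<open>Pr(T = S)\<close> over the sets \<open>S\<close> of size \<open>s\<close>, so the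
  unknown function can be eliminated from the definition.\<close>

lemma (in prob_space) cardinality_symmetric_iff:
  assumes meas: "\<And>i. i \<in> {1..n} \<Longrightarrow> X i \<in> borel_measurable M"
  shows "cardinality_symmetric M L n X \<longleftrightarrow>
    (\<forall>x\<in>L. \<forall>S. S \<subseteq> {1..n} \<longrightarrow>
       \<P>(\<omega> in M. exceedance_set n x (\<lambda>i. X i \<omega>) = S) =
       \<P>(\<omega> in M. card (exceedance_set n x (\<lambda>i. X i \<omega>)) = card S) / real (n choose card S))"
    (is "_ \<longleftrightarrow> (\<forall>x\<in>L. \<forall>S. S \<subseteq> {1..n} \<longrightarrow> ?p x S = ?q x (card S) / _)")
proof -
  have vec: "\<P>(\<omega> in M. indicator_vec n X x \<omega> = \<kappa>) = ?p x {i \<in> {1..n}. \<kappa> i = 1}"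
    if "\<kappa> \<in> {1..n} \<rightarrow>\<^sub>E {0, 1}" for \<kappa> x
    by (simp only: indicator_vec_eq_iff[OF that])
  show ?thesis
  proof
    assume sym: "cardinality_symmetric M L n X"
    show "\<forall>x\<in>L. \<forall>S. S \<subseteq> {1..n} \<longrightarrow> ?p x S = ?q x (card S) / real (n choose card S)"
    proof (intro ballI allI impI)
      fix x S assume "x \<in> L" and S: "S \<subseteq> {1..n}"
      with sym obtain g :: "nat \<Rightarrow> real"
        where g: "\<And>\<kappa>. \<kappa> \<in> {1..n} \<rightarrow>\<^sub>E {0, 1} \<Longrightarrow>
          \<P>(\<omega> in M. indicator_vec n X x \<omega> = \<kappa>) = g (\<Sum>i=1..n. \<kappa> i)"
        unfolding cardinality_symmetric_def by blast
      have pg: "?p x R = g (card R)" if R: "R \<subseteq> {1..n}" for R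
      proof -
        let ?\<kappa> = "\<lambda>i\<in>{1..n}. of_bool (i \<in> R) :: nat"
        have \<kappa>: "?\<kappa> \<in> {1..n} \<rightarrow>\<^sub>E {0, 1}"
          by auto
        have "{i \<in> {1..n}. ?\<kappa> i = 1} = R"
          using R by auto
        then show ?thesis
          using g[OF \<kappa>] vec[OF \<kappa>, of x] sum_zero_one_vec[OF \<kappa>] by simp
      qed
      have "?q x (card S) = (\<Sum>R | R \<subseteq> {1..n} \<and> card R = card S. ?p x R)"
        by (rule prob_exceedance[OF meas])
      also have "\<dots> = (\<Sum>R | R \<subseteq> {1..n} \<and> card R = card S. g (card S))"
        by (intro sum.cong) (auto simp: pg)
      also have "\<dots> = real (n choose card S) * ?p x S"
        by (simp add: n_subsets pg[OF S])
      finally show "?p x S = ?q x (card S) / real (n choose card S)"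
        using card_mono[OF finite_atLeastAtMost S] by simp
    qed
  next
    assume avg: "\<forall>x\<in>L. \<forall>S. S \<subseteq> {1..n} \<longrightarrow> ?p x S = ?q x (card S) / real (n choose card S)"
    show "cardinality_symmetric M L n X"
      unfolding cardinality_symmetric_def
    proof (intro ballI exI conjI)
      fix x assume "x \<in> L"
      let ?g = "\<lambda>s. ?q x s / real (n choose s)"
      show "?g \<in> {0..n} \<rightarrow> {0..1}"
      proof
        fix s assume "s \<in> {0..n}"
        then have "0 < n choose s"
          by simp
        then have "1 \<le> real (n choose s)"
          by linarith
        moreover have "?q x s \<le> 1"
          by (rule prob_le_1)
        ultimately have "?q x s \<le> real (n choose s)"
          by linarith
        then show "?g s \<in> {0..1}"
          by (auto simp: divide_le_eq)
      qed
      show "\<P>(\<omega> in M. indicator_vec n X x \<omega> = \<kappa>) = ?g (\<Sum>i=1..n. \<kappa> i)"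
        if \<kappa>: "\<kappa> \<in> {1..n} \<rightarrow>\<^sub>E {0, 1}" for \<kappa>
        unfolding vec[OF \<kappa>] sum_zero_one_vec[OF \<kappa>]
        by (rule avg[rule_format, OF \<open>x \<in> L\<close>]) blast
    qed
  qed
qed

theorem theorem16:
  fixes M :: "'a measure" and L :: "ereal set" and a b :: ereal
    and n :: nat and X :: "nat \<Rightarrow> 'a \<Rightarrow> ereal"
  assumes "prob_space M"
    and "a \<in> L" and "b \<in> L" and "L \<subseteq> {a..b}"
    and "\<And>i. i \<in> {1..n} \<Longrightarrow> X i \<in> M \<rightarrow>\<^sub>M restrict_space borel L"
  shows "(\<forall>w :: nat set \<Rightarrow> ereal. w \<in> Pow {1..n} \<rightarrow> L \<longrightarrow> mono_on (Pow {1..n}) w \<longrightarrow>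
            (\<forall>y\<in>L. 1 - ereal_cdf M (\<lambda>\<omega>. weighted_lattice_poly b n w (\<lambda>i. X i \<omega>)) y =
               (\<Sum>s=0..n. omega_bar n w y s *
                  (order_stat_cdf M n X (n - s) y - order_stat_cdf M n X (n - s + 1) y))))
         \<longleftrightarrow> cardinality_symmetric M L n X"
proof -
  interpret prob_space M
    by fact
  have meas: "X i \<in> borel_measurable M" if "i \<in> {1..n}" for i
    using assms(5)[OF that] by (simp add: measurable_restrict_space2_iff)
  have X_le: "X i \<omega> \<le> b" if "i \<in> {1..n}" "\<omega> \<in> space M" for i \<omega>
    using assms(4) assms(5)[OF that(1)] that(2) by (auto simp: measurable_restrict_space2_iff)
  define p where "p y S = \<P>(\<omega> in M. exceedance_set n y (\<lambda>i. X i \<omega>) = S)" for y S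
  define r where "r y S = \<P>(\<omega> in M. card (exceedance_set n y (\<lambda>i. X i \<omega>)) = card S) /
    real (n choose card S)" for y and S :: "nat set"
  have symmetric_iff: "cardinality_symmetric M L n X \<longleftrightarrow> (\<forall>y\<in>L. \<forall>S. S \<subseteq> {1..n} \<longrightarrow> p y S = r y S)"
    unfolding p_def r_def by (rule cardinality_symmetric_iff) (rule meas)
  have identity_iff:
    "1 - ereal_cdf M (\<lambda>\<omega>. weighted_lattice_poly b n w (\<lambda>i. X i \<omega>)) y =
       (\<Sum>s=0..n. omega_bar n w y s *
          (order_stat_cdf M n X (n - s) y - order_stat_cdf M n X (n - s + 1) y)) \<longleftrightarrow>
     sum (p y) {S. S \<subseteq> {1..n} \<and> y < w S} = sum (r y) {S. S \<subseteq> {1..n} \<and> y < w S}"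
    if w: "w \<in> Pow {1..n} \<rightarrow> L" "mono_on (Pow {1..n}) w" for w y
  proof -
    have bound: "w S \<le> b" if "S \<subseteq> {1..n}" for S
      using funcset_mem[OF w(1)] assms(4) that by (meson PowI atLeastAtMost_iff subsetD)
    have "(\<Sum>s=0..n. omega_bar n w y s *
            (order_stat_cdf M n X (n - s) y - order_stat_cdf M n X (n - s + 1) y)) =
          (\<Sum>s=0..n. omega_bar n w y s * \<P>(\<omega> in M. card (exceedance_set n y (\<lambda>i. X i \<omega>)) = s))"
      by (intro sum.cong refl) (subst order_stat_cdf_diff[OF meas], auto)
    also have "\<dots> = sum (r y) {S. S \<subseteq> {1..n} \<and> y < w S}"
      unfolding r_def by (rule sum_omega_bar)
    finally have rhs: "(\<Sum>s=0..n. omega_bar n w y s *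
            (order_stat_cdf M n X (n - s) y - order_stat_cdf M n X (n - s + 1) y)) =
          sum (r y) {S. S \<subseteq> {1..n} \<and> y < w S}" .
    have lhs: "1 - ereal_cdf M (\<lambda>\<omega>. weighted_lattice_poly b n w (\<lambda>i. X i \<omega>)) y =
          sum (p y) {S. S \<subseteq> {1..n} \<and> y < w S}"
      unfolding p_def by (rule one_minus_cdf_weighted_lattice_poly[OF meas w(2) bound])
    show ?thesis
      unfolding lhs rhs ..
  qed
  show ?thesis
    unfolding symmetric_iff
  proof (intro iffI ballI allI impI)
    fix w y
    assume "\<forall>y\<in>L. \<forall>S. S \<subseteq> {1..n} \<longrightarrow> p y S = r y S" "y \<in> L"
      and w: "w \<in> Pow {1..n} \<rightarrow> L" "mono_on (Pow {1..n}) w"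
    then show "1 - ereal_cdf M (\<lambda>\<omega>. weighted_lattice_poly b n w (\<lambda>i. X i \<omega>)) y =
       (\<Sum>s=0..n. omega_bar n w y s *
          (order_stat_cdf M n X (n - s) y - order_stat_cdf M n X (n - s + 1) y))"
      unfolding identity_iff[OF w] by (intro sum.cong) auto
  next
    fix y K
    assume identity: "\<forall>w. w \<in> Pow {1..n} \<rightarrow> L \<longrightarrow> mono_on (Pow {1..n}) w \<longrightarrow>
        (\<forall>y\<in>L. 1 - ereal_cdf M (\<lambda>\<omega>. weighted_lattice_poly b n w (\<lambda>i. X i \<omega>)) y =
           (\<Sum>s=0..n. omega_bar n w y s *
              (order_stat_cdf M n X (n - s) y - order_stat_cdf M n X (n - s + 1) y)))"
      and y: "y \<in> L" and K: "K \<subseteq> {1..n}"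
    show "p y K = r y K"
    proof (cases "y < b")
      case True
      show ?thesis
      proof (rule up_set_sums_determine[OF finite_atLeastAtMost K])
        fix U assume U: "U \<subseteq> Pow {1..n}"
          and up: "\<And>S T. S \<in> U \<Longrightarrow> S \<subseteq> T \<Longrightarrow> T \<subseteq> {1..n} \<Longrightarrow> T \<in> U"
        \<comment> \<open>As \<open>a \<le> y < b\<close>, this two-valued \<open>w\<close> has \<open>U\<close> as the family of sets where it exceeds \<open>y\<close>.\<close>
        let ?w = "\<lambda>S. if S \<in> U then b else a"
        have "a \<le> b" "a \<le> y"
          using assms(2,4) y by auto
        have w: "?w \<in> Pow {1..n} \<rightarrow> L" "mono_on (Pow {1..n}) ?w"
          using assms(2,3) up \<open>a \<le> b\<close> by (auto intro!: mono_onI)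
        have "{S. S \<subseteq> {1..n} \<and> y < ?w S} = U"
          using U True \<open>a \<le> y\<close> by auto
        then show "sum (p y) U = sum (r y) U"
          using identity_iff[OF w, of y] identity w y by simp
      qed
    next
      case False
      \<comment> \<open>No lattice value exceeds the top element, so at \<open>y = b\<close> the identity reads \<open>0 = 0\<close>; but there
        the exceedance set is always empty, and its law is trivially symmetric.\<close>
      then have "exceedance_set n y (\<lambda>i. X i \<omega>) = {}" if "\<omega> \<in> space M" for \<omega>
        using X_le[OF _ that] by (force simp: exceedance_set_def)
      then have "p y K = \<P>(\<omega> in M. K = {})"
        "r y K = \<P>(\<omega> in M. card K = 0) / real (n choose card K)"
        unfolding p_def r_def by (auto intro!: arg_cong[where f = prob] arg_cong2[where f = "(/)"])
      then show ?thesis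
        using finite_subset[OF K] by (cases "K = {}") auto
    qed
  qed
qed

end
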